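(* Let $G$ be a connected graph of non-QE class with $n$ vertices and let $K_m$ be the complete graph on $m$ vertices. Then $$\mathrm{QEC}(K_m\times G)=m\,\mathrm{QEC}(G).$$
   Context: All graphs are finite, simple and unweighted (undirected). For a connected graph $G=(V,E)$, $D_G$ is its distance matrix (entries are shortest-path distances), and the quadratic embedding constant is $\mathrm{QEC}(G):=\max\{\langle f,D_Gf\rangle : f\in\mathbb{R}^{V},\ \langle f,f\rangle=1,\ \langle e,f\rangle=0\}$, where $e$ is the all-ones vector and $\langle\cdot,\cdot\rangle$ the standard inner product. A connected graph $G=(V,E)$ is of QE class if there is a map $\psi:V\to\mathcal{H}$ into a Euclidean space with $d(i,j)=\|\psi(i)-\psi(j)\|^2$ for all $i,j\in V$, where $d$ is the graph distance; by Schoenberg's theorem this is equivalent to $\mathrm{QEC}(G)\le 0$. It is of non-QE class otherwise, i.e. if $\mathrm{QEC}(G)>0$. The Cartesian product $G_1\times G_2$ of $G_1=(V_1,E_1)$ and $G_2=(V_2,E_2)$ has vertex set $V_1\times V_2$, with $(u,v)$ and $(u',v')$ adjacent iff either $u\sim u'$ in $G_1$ and $v=v'$, or $u=u'$ and $v\sim v'$ in $G_2$. *)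

theory Defs
  imports "HOL-Analysis.L2_Norm" "Graph_Theory.Graph_Theory"
begin

text \<open>
  A finite simple graph is a \<open>pair_graph\<close>: a finite, loop-free, symmetric digraph whose arcs are
  pairs of vertices, so that every edge appears as two opposite arcs. The notions of connectedness,
  of shortest-path length \<open>\<mu>\<close> and of complete graphs are those of the library. The coercion
  \<open>with_proj\<close> turns the pair representation into a general digraph.

  The library's \<open>\<mu>\<close> is the extended-real infimum of walk costs. With unit arc weights it is the
  graph distance; on a connected graph it is always finite, so that \<open>real_of_ereal\<close> loses nothing.
\<close>

definition graph_dist :: "'a pair_pre_digraph \<Rightarrow> 'a \<Rightarrow> 'a \<Rightarrow> real" where
  "graph_dist G u v = real_of_ereal (wf_digraph.\<mu> (with_proj G) (\<lambda>_. 1) u v)"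

text \<open>
  An element of \<open>\<real>\<^sup>V\<close> is represented by a function on the whole vertex type; only its values on the
  vertex set enter. \<open>GREATEST\<close> denotes the greatest element, i.e. the maximum, and is meaningful
  for connected graphs with at least two vertices.
\<close>

definition QEC :: "'a pair_pre_digraph \<Rightarrow> real" where
  "QEC G = (GREATEST q. \<exists>f :: 'a \<Rightarrow> real.
     (\<Sum>i\<in>pverts G. f i * f i) = 1 \<and>
     (\<Sum>i\<in>pverts G. f i) = 0 \<and>
     q = (\<Sum>i\<in>pverts G. f i * (\<Sum>j\<in>pverts G. graph_dist G i j * f j)))"

text \<open>
  The Euclidean space is \<open>\<real>\<^sup>N\<close> for an arbitrary \<open>N\<close>, its points being represented by their coordinates
  with index below \<open>N\<close>; \<open>L2_set\<close> is the Euclidean norm.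
\<close>

definition QE_class :: "'a pair_pre_digraph \<Rightarrow> bool" where
  "QE_class G \<longleftrightarrow> (\<exists>(N :: nat) (\<psi> :: 'a \<Rightarrow> nat \<Rightarrow> real).
     \<forall>i\<in>pverts G. \<forall>j\<in>pverts G. graph_dist G i j = (L2_set (\<lambda>k. \<psi> i k - \<psi> j k) {..<N})\<^sup>2)"

definition cartesian_product ::
    "'a pair_pre_digraph \<Rightarrow> 'b pair_pre_digraph \<Rightarrow> ('a \<times> 'b) pair_pre_digraph" where
  "cartesian_product G H = \<lparr> pverts = pverts G \<times> pverts H,
     parcs = {((u, v), (u', v')) | u v u' v'.
       ((u, u') \<in> parcs G \<and> v = v' \<and> v \<in> pverts H) \<or>
       (u = u' \<and> u \<in> pverts G \<and> (v, v') \<in> parcs H)} \<rparr>"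

end

theory Submission
  imports Defs "HOL-Analysis.Function_Topology" "HOL-Analysis.Convex"
begin

text \<open>
  Distances add over the two coordinates of a Cartesian product, and in a complete graph distinct
  vertices are at distance 1. Hence, for \<open>f\<close> with sum zero on \<open>K \<times> G\<close>, the distance form splits as
  \<open>\<langle>f, D f\<rangle> = \<langle>g, D\<^sub>G g\<rangle> - (\<Sum>x. F(x)\<^sup>2)\<close>, where \<open>g(u)\<close> sums \<open>f\<close> over the copies of the vertex \<open>u\<close> and
  \<open>F(x)\<close> sums \<open>f\<close> over the layer of \<open>G\<close> at \<open>x\<close> (\<open>quad_form_complete_product\<close>).

  Upper bound: \<open>g\<close> has sum zero and Cauchy-Schwarz gives \<open>|g|\<^sup>2 \<le> m |f|\<^sup>2\<close>, so
  \<open>\<langle>f, D f\<rangle> \<le> QEC(G) |g|\<^sup>2 \<le> m QEC(G) |f|\<^sup>2\<close>. The last inequality is where \<open>QEC(G) \<ge> 0\<close> matters.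
  Equality: if every layer carries the same maximizer of \<open>G\<close>, scaled by \<open>1 / \<surd>m\<close>, then all \<open>F(x)\<close>
  vanish and both estimates are sharp. The maximum for the product is thus exhibited, and only the
  maximum for \<open>G\<close> has to be shown to exist (\<open>quad_form_attains_max\<close>, by compactness).

  Positivity of \<open>QEC(G)\<close> is Schoenberg's theorem: if the distance form were nonpositive on all vectors
  with sum zero, factoring a positive semidefinite matrix into Gram vectors would give a quadratic
  embedding of \<open>G\<close> (\<open>conditionally_negative_imp_squared_distances\<close>).
\<close>

section \<open>Quadratic forms over a finite index set\<close>

definition quad_form :: "'a set \<Rightarrow> ('a \<Rightarrow> 'a \<Rightarrow> real) \<Rightarrow> ('a \<Rightarrow> real) \<Rightarrow> real" where
  "quad_form V A f = (\<Sum>i\<in>V. f i * (\<Sum>j\<in>V. A i j * f j))"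

lemma quad_form_double_sum:
  "quad_form V A f = (\<Sum>i\<in>V. \<Sum>j\<in>V. A i j * (f i * f j))"
  by (simp add: quad_form_def sum_distrib_left mult_ac)

lemma quad_form_cong:
  assumes "\<And>i j. i \<in> V \<Longrightarrow> j \<in> V \<Longrightarrow> A i j = B i j" "\<And>i. i \<in> V \<Longrightarrow> f i = g i"
  shows "quad_form V A f = quad_form V B g"
  unfolding quad_form_double_sum using assms by (intro sum.cong) auto

lemma quad_form_add:
  "quad_form V (\<lambda>i j. A i j + B i j) f = quad_form V A f + quad_form V B f"
  by (simp add: quad_form_double_sum sum.distrib distrib_right)

lemma quad_form_diff:
  "quad_form V (\<lambda>i j. A i j - B i j) f = quad_form V A f - quad_form V B f"
  by (simp add: quad_form_double_sum sum_subtractf left_diff_distrib)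

lemma quad_form_scale: "quad_form V A (\<lambda>i. c * f i) = c\<^sup>2 * quad_form V A f"
  by (simp add: quad_form_double_sum sum_distrib_left power2_eq_square mult_ac)

lemma quad_form_rank_one:
  "quad_form V (\<lambda>i j. a i * b j) f = (\<Sum>i\<in>V. a i * f i) * (\<Sum>j\<in>V. b j * f j)"
  by (simp add: quad_form_double_sum sum_product mult_ac)

lemma quad_form_insert:
  assumes "finite V" "a \<notin> V" "\<And>i. i \<in> V \<Longrightarrow> B i a = B a i"
  shows "quad_form (insert a V) B (g(a := t)) =
    quad_form V B g + 2 * t * (\<Sum>j\<in>V. B a j * g j) + t\<^sup>2 * B a a"
proof -
  let ?f = "g(a := t)"
  have f: "?f i = g i" if "i \<in> V" for i using that assms(2) by auto
  have row: "(\<Sum>j\<in>insert a V. B i j * ?f j) = B i a * t + (\<Sum>j\<in>V. B i j * g j)" for i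
    using assms(1,2) by (auto simp: intro!: sum.cong)
  have "(\<Sum>i\<in>V. ?f i * (B i a * t + (\<Sum>j\<in>V. B i j * g j))) =
      (\<Sum>i\<in>V. g i * (B a i * t + (\<Sum>j\<in>V. B i j * g j)))"
    using f assms(3) by (intro sum.cong) auto
  also have "\<dots> = t * (\<Sum>j\<in>V. B a j * g j) + quad_form V B g"
    by (simp add: quad_form_def distrib_left sum.distrib sum_distrib_left mult_ac)
  finally show ?thesis
    unfolding quad_form_def[of "insert a V"] row using assms(1,2)
    by (simp add: algebra_simps power2_eq_square)
qed

section \<open>Gram vectors and the criterion of Schoenberg\<close>

text \<open>
  One step of the Cholesky factorization per index. The column of the new index \<open>a\<close>, divided by
  \<open>sqrt (B a a)\<close>, becomes the last coordinate, and the Schur complement that remains on \<open>V\<close> is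
  again positive semidefinite because minimizing the form over the coordinate at \<open>a\<close> gives its values.
\<close>

lemma positive_semidefinite_Gram:
  assumes "finite V"
    and "\<And>i j. i \<in> V \<Longrightarrow> j \<in> V \<Longrightarrow> B i j = B j i"
    and "\<And>f. 0 \<le> quad_form V B f"
  shows "\<exists>(N :: nat) (\<psi> :: 'a \<Rightarrow> nat \<Rightarrow> real).
    \<forall>i\<in>V. \<forall>j\<in>V. B i j = (\<Sum>k<N. \<psi> i k * \<psi> j k)"
  using assms
proof (induction V arbitrary: B)
  case empty
  then show ?case by simp
next
  case (insert a V)
  have sym: "B i a = B a i" if "i \<in> V" for i using insert.prems(1) that by auto
  have expand: "quad_form (insert a V) B (g(a := t)) =
      quad_form V B g + 2 * t * (\<Sum>j\<in>V. B a j * g j) + t\<^sup>2 * B a a" for g t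
    using insert.hyps sym by (rule quad_form_insert)
  have diag: "0 \<le> B a a"
    using insert.prems(2)[of "(\<lambda>_. 0)(a := 1)"] unfolding expand by (simp add: quad_form_def)
  have vanish: "B a j = 0" if "B a a = 0" "j \<in> V" for j
  proof (rule ccontr)
    assume nz: "B a j \<noteq> 0"
    let ?e = "\<lambda>i. of_bool (i = j) :: real"
    have "(\<Sum>i\<in>V. B a i * ?e i) = B a j"
      using insert.hyps(1) that(2) by (simp add: of_bool_def sum.delta if_distrib cong: if_cong)
    \<comment> \<open>the form is affine in the coordinate at \<open>a\<close>; the value chosen for it makes the form \<open>-1\<close>\<close>
    then show False
      using insert.prems(2)[of "?e(a := - (quad_form V B ?e + 1) / (2 * B a j))"] nz that(1)
      unfolding expand by (simp add: field_simps)
  qed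
  define c where "c i = B i a / sqrt (B a a)" for i
  have c_mult: "c i * c a = B i a" if "i \<in> insert a V" for i
    using that diag vanish sym by (cases "B a a = 0") (auto simp: c_def real_div_sqrt)
  define B' where "B' i j = B i j - c i * c j" for i j
  have psd: "0 \<le> quad_form V B' g" for g
  proof -
    let ?S = "\<Sum>j\<in>V. B a j * g j"
    have "(\<Sum>i\<in>V. c i * g i) = ?S / sqrt (B a a)"
      unfolding sum_divide_distrib using sym by (intro sum.cong) (auto simp: c_def)
    then have "quad_form V B' g = quad_form V B g - ?S\<^sup>2 / B a a"
      using diag unfolding B'_def quad_form_diff quad_form_rank_one
      by (simp add: power2_eq_square)
    also have "\<dots> = quad_form (insert a V) B (g(a := - ?S / B a a))"
      unfolding expand by (cases "B a a = 0") (simp_all add: field_simps power2_eq_square)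
    finally show ?thesis using insert.prems(2) by simp
  qed
  have "B' i j = B' j i" if "i \<in> V" "j \<in> V" for i j
    using that insert.prems(1) by (simp add: B'_def)
  from insert.IH[OF this psd] obtain N and \<psi> :: "'a \<Rightarrow> nat \<Rightarrow> real"
    where \<psi>: "\<forall>i\<in>V. \<forall>j\<in>V. B' i j = (\<Sum>k<N. \<psi> i k * \<psi> j k)" by blast
  define \<phi> where "\<phi> i k = (if k = N then c i else if i = a then 0 else \<psi> i k)" for i k
  have "B i j = (\<Sum>k<Suc N. \<phi> i k * \<phi> j k)" if "i \<in> insert a V" "j \<in> insert a V" for i j
  proof (cases "i = a \<or> j = a")
    case True
    then have "(\<Sum>k<N. \<phi> i k * \<phi> j k) = 0" by (intro sum.neutral) (auto simp: \<phi>_def)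
    moreover have "c i * c j = B i j"
      using True c_mult that insert.prems(1) by (metis mult.commute)
    ultimately show ?thesis by (simp add: \<phi>_def)
  next
    case False
    then have "(\<Sum>k<N. \<phi> i k * \<phi> j k) = B' i j"
      using \<psi> that by (auto simp: \<phi>_def intro!: sum.cong)
    then show ?thesis by (simp add: \<phi>_def B'_def)
  qed
  then show ?case by blast
qed

text \<open>
  One direction of Schoenberg's criterion. If an embedding placed a base point \<open>b\<close> at the origin, the
  polarization identity would force \<open>(d i b + d b j - d i j) / 2\<close> to be the inner product of the
  images of \<open>i\<close> and \<open>j\<close>. This kernel is positive semidefinite: subtracting the total mass of \<open>f\<close> at \<open>b\<close>
  turns \<open>f\<close> into a vector with sum zero, and the kernel's form at \<open>f\<close> is \<open>-1/2\<close> times the form of \<open>d\<close>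
  at that vector.
\<close>

lemma conditionally_negative_imp_squared_distances:
  assumes "finite V"
    and sym: "\<And>i j. i \<in> V \<Longrightarrow> j \<in> V \<Longrightarrow> d i j = d j i"
    and diag: "\<And>i. i \<in> V \<Longrightarrow> d i i = 0"
    and neg: "\<And>f. (\<Sum>i\<in>V. f i) = 0 \<Longrightarrow> quad_form V d f \<le> 0"
  shows "\<exists>(N :: nat) (\<psi> :: 'a \<Rightarrow> nat \<Rightarrow> real).
    \<forall>i\<in>V. \<forall>j\<in>V. d i j = (L2_set (\<lambda>k. \<psi> i k - \<psi> j k) {..<N})\<^sup>2"
proof (cases "V = {}")
  case True
  then show ?thesis by simp
next
  case False
  then obtain b where b: "b \<in> V" by auto
  define B where "B i j = (d i b + d b j - d i j) / 2" for i j
  have psd: "0 \<le> quad_form V B f" for f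
  proof -
    define s where "s = (\<Sum>i\<in>V. f i)"
    define g where "g i = f i - s * of_bool (i = b)" for i
    have pick: "(\<Sum>i\<in>V. h i * of_bool (i = b)) = h b" for h :: "'a \<Rightarrow> real"
      using b assms(1) by (simp add: of_bool_def if_distrib sum.delta cong: if_cong)
    have g0: "(\<Sum>i\<in>V. g i) = 0"
      using pick[of "\<lambda>_. s"] by (simp add: g_def sum_subtractf s_def)
    have "(\<Sum>j\<in>V. d i j * g j) = (\<Sum>j\<in>V. d i j * f j) - s * d i b" for i
      using pick[of "\<lambda>j. s * d i j"]
      by (simp add: g_def right_diff_distrib sum_subtractf mult_ac)
    then have "quad_form V d g = (\<Sum>i\<in>V. g i * ((\<Sum>j\<in>V. d i j * f j) - s * d i b))"
      by (simp add: quad_form_def)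
    also have "\<dots> = (\<Sum>i\<in>V. f i * ((\<Sum>j\<in>V. d i j * f j) - s * d i b))
        - s * ((\<Sum>j\<in>V. d b j * f j) - s * d b b)"
      using pick[of "\<lambda>i. s * ((\<Sum>j\<in>V. d i j * f j) - s * d i b)"]
      by (simp add: g_def left_diff_distrib sum_subtractf mult_ac)
    also have "\<dots> = quad_form V d f - s * (\<Sum>i\<in>V. d i b * f i) - s * (\<Sum>j\<in>V. d b j * f j)"
      using diag[OF b]
      by (simp add: quad_form_def right_diff_distrib sum_subtractf sum_distrib_left mult_ac)
    finally have dg: "quad_form V d g =
      quad_form V d f - s * (\<Sum>i\<in>V. d i b * f i) - s * (\<Sum>j\<in>V. d b j * f j)" .
    have "quad_form V B f = quad_form V (\<lambda>i j. (d i b / 2) * 1 + (1 / 2) * d b j - d i j / 2) f"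
      by (intro quad_form_cong) (auto simp: B_def field_simps)
    also have "\<dots> = (\<Sum>i\<in>V. (d i b / 2) * f i) * s + (\<Sum>i\<in>V. (1 / 2) * f i) * (\<Sum>j\<in>V. d b j * f j)
        - quad_form V d f / 2"
      unfolding quad_form_diff quad_form_add quad_form_rank_one
      by (simp add: s_def quad_form_double_sum sum_divide_distrib)
    also have "\<dots> = - quad_form V d g / 2"
      unfolding dg by (simp add: s_def field_simps flip: sum_divide_distrib)
    finally show ?thesis using neg[OF g0] by simp
  qed
  have "B i j = B j i" if "i \<in> V" "j \<in> V" for i j
    using that b sym[of i b] sym[of b j] sym[of i j] by (simp add: B_def)
  from positive_semidefinite_Gram[OF assms(1) this psd]
  obtain N and \<psi> :: "'a \<Rightarrow> nat \<Rightarrow> real"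
    where \<psi>: "\<forall>i\<in>V. \<forall>j\<in>V. B i j = (\<Sum>k<N. \<psi> i k * \<psi> j k)" by blast
  have "d i j = (L2_set (\<lambda>k. \<psi> i k - \<psi> j k) {..<N})\<^sup>2" if ij: "i \<in> V" "j \<in> V" for i j
  proof -
    have "(L2_set (\<lambda>k. \<psi> i k - \<psi> j k) {..<N})\<^sup>2 = (\<Sum>k<N. (\<psi> i k - \<psi> j k)\<^sup>2)"
      by (simp add: L2_set_def sum_nonneg)
    also have "\<dots> = B i i + B j j - 2 * B i j"
      using \<psi> ij
      by (simp add: power2_eq_square algebra_simps sum.distrib sum_subtractf sum_distrib_left)
    also have "\<dots> = d i j"
      using diag ij b sym[of i b] sym[of b j] by (simp add: B_def field_simps)
    finally show ?thesis by simp
  qed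
  then show ?thesis by blast
qed

section \<open>Maximizing a quadratic form on the unit sphere of a hyperplane\<close>

text \<open>
  The vectors are functions on a possibly infinite type, so compactness is available only after they
  are normalized to vanish outside \<open>V\<close>; they then lie in a Tychonoff product of compact intervals.
\<close>

lemma quad_form_attains_max:
  fixes A :: "'a \<Rightarrow> 'a \<Rightarrow> real" and f0 :: "'a \<Rightarrow> real"
  assumes "finite V" and "(\<Sum>i\<in>V. f0 i * f0 i) = 1" "(\<Sum>i\<in>V. f0 i) = 0"
  shows "\<exists>h. (\<Sum>i\<in>V. h i * h i) = 1 \<and> (\<Sum>i\<in>V. h i) = 0 \<and>
    (\<forall>f. (\<Sum>i\<in>V. f i * f i) = 1 \<longrightarrow> (\<Sum>i\<in>V. f i) = 0 \<longrightarrow>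
      quad_form V A f \<le> quad_form V A h)"
proof -
  define box where "box = PiE UNIV (\<lambda>i. if i \<in> V then {-1..1} else {0 :: real})"
  define S where "S = box \<inter> ({f. (\<Sum>i\<in>V. f i * f i) = 1} \<inter> {f. (\<Sum>i\<in>V. f i) = 0})"
  have "compactin (product_topology (\<lambda>i. euclidean) UNIV) box"
    unfolding box_def compactin_PiE by auto
  then have "compact box" unfolding euclidean_product_topology by simp
  moreover have "closed ({f :: 'a \<Rightarrow> real. (\<Sum>i\<in>V. f i * f i) = 1} \<inter> {f. (\<Sum>i\<in>V. f i) = 0})"
    by (intro closed_Int closed_Collect_eq continuous_intros continuous_on_product_coordinates)
  ultimately have "compact S" unfolding S_def by (rule compact_Int_closed)
  have cont: "continuous_on S (quad_form V A)"
    unfolding quad_form_def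
    by (intro continuous_intros continuous_on_subset[OF continuous_on_product_coordinates]) auto
  have trunc: "(\<lambda>i. if i \<in> V then f i else 0) \<in> S"
    if f: "(\<Sum>i\<in>V. f i * f i) = 1" "(\<Sum>i\<in>V. f i) = 0" for f :: "'a \<Rightarrow> real"
  proof -
    have "\<bar>f i\<bar> \<le> 1" if "i \<in> V" for i
    proof -
      have "f i * f i \<le> (\<Sum>i\<in>V. f i * f i)"
        using assms(1) that by (intro member_le_sum) auto
      then have "(f i)\<^sup>2 \<le> 1" by (simp add: f power2_eq_square)
      then show ?thesis by (simp add: abs_square_le_1)
    qed
    then show ?thesis using f by (auto simp: S_def box_def abs_le_iff cong: sum.cong)
  qed
  then have "S \<noteq> {}" using assms(2,3) by blast
  from continuous_attains_sup[OF \<open>compact S\<close> this cont]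
  obtain h where h: "h \<in> S" "\<And>f. f \<in> S \<Longrightarrow> quad_form V A f \<le> quad_form V A h" by blast
  show ?thesis
  proof (intro exI[of _ h] conjI allI impI)
    show "(\<Sum>i\<in>V. h i * h i) = 1" "(\<Sum>i\<in>V. h i) = 0" using h(1) by (auto simp: S_def)
    fix f :: "'a \<Rightarrow> real"
    assume f: "(\<Sum>i\<in>V. f i * f i) = 1" "(\<Sum>i\<in>V. f i) = 0"
    have "quad_form V A f = quad_form V A (\<lambda>i. if i \<in> V then f i else 0)"
      by (intro quad_form_cong) auto
    then show "quad_form V A f \<le> quad_form V A h" using h(2)[OF trunc[OF f]] by simp
  qed
qed

section \<open>Graph distance\<close>

text \<open>
  Powers of the arc relation count steps, so that the walks of a product graph are handled by
  induction on numbers instead of on lists of arcs.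
\<close>

lemma (in pair_wf_digraph) awalk_length_iff_relpow:
  "(\<exists>p. awalk u p v \<and> length p = k) \<longleftrightarrow> u \<in> pverts G \<and> (u, v) \<in> parcs G ^^ k"
proof (induction k arbitrary: u)
  case 0
  then show ?case by (auto simp: awalk_Nil_iff)
next
  case (Suc k)
  have "(\<exists>p. awalk u p v \<and> length p = Suc k) \<longleftrightarrow>
      (\<exists>w. (u, w) \<in> parcs G \<and> (\<exists>p. awalk w p v \<and> length p = k))" (is "?L \<longleftrightarrow> ?R")
  proof
    assume ?L
    then obtain e q where "awalk u (e # q) v" "length q = k" by (auto simp: length_Suc_conv)
    then show ?R by (cases e) (auto simp: awalk_Cons_iff)
  next
    assume ?R
    then obtain w p where "(u, w) \<in> parcs G" "awalk w p v" "length p = k" by blast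
    then show ?L by (intro exI[of _ "(u, w) # p"]) (simp add: awalk_Cons_iff)
  qed
  also have "\<dots> \<longleftrightarrow> (\<exists>w. (u, w) \<in> parcs G \<and> (w, v) \<in> parcs G ^^ k)"
    unfolding Suc.IH using in_arcsD2 by blast
  also have "\<dots> \<longleftrightarrow> (u, v) \<in> parcs G ^^ Suc k"
    using relpow_Suc_D2[of u v k] relpow_Suc_I2[of u _ "parcs G" v k] by blast
  also have "\<dots> \<longleftrightarrow> u \<in> pverts G \<and> (u, v) \<in> parcs G ^^ Suc k"
    using relpow_Suc_D2[of u v k] in_arcsD1 by blast
  finally show ?case .
qed

lemma graph_dist_eqI:
  assumes "pair_wf_digraph G" "u \<in> pverts G"
    and walk: "(u, v) \<in> parcs G ^^ k"
    and shortest: "\<And>l. (u, v) \<in> parcs G ^^ l \<Longrightarrow> k \<le> l"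
  shows "graph_dist G u v = real k"
proof -
  interpret pair_wf_digraph G by fact
  have cost: "awalk_cost (\<lambda>_. 1) p = real (length p)" for p :: "('a \<times> 'a) list"
    by (induction p) auto
  have "\<mu> (\<lambda>_. 1) u v = ereal (real k)"
    unfolding \<mu>_def cost
  proof (rule antisym)
    obtain p where "awalk u p v" "length p = k"
      using awalk_length_iff_relpow assms(2) walk by blast
    then show "(INF p\<in>{p. awalk u p v}. ereal (real (length p))) \<le> ereal (real k)"
      by (intro INF_lower2[of p]) auto
    show "ereal (real k) \<le> (INF p\<in>{p. awalk u p v}. ereal (real (length p)))"
      using awalk_length_iff_relpow shortest by (intro INF_greatest) auto
  qed
  then show ?thesis by (simp add: graph_dist_def)
qed

lemma graph_dist_attained:
  assumes "pair_wf_digraph G" "u \<in> pverts G" "(u, v) \<in> (parcs G)\<^sup>*"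
  shows "\<exists>k. graph_dist G u v = real k \<and> (u, v) \<in> parcs G ^^ k \<and>
    (\<forall>l. (u, v) \<in> parcs G ^^ l \<longrightarrow> k \<le> l)"
proof -
  define k where "k = (LEAST k. (u, v) \<in> parcs G ^^ k)"
  from assms(3) have "\<exists>k. (u, v) \<in> parcs G ^^ k" by (simp add: rtrancl_power)
  then have walk: "(u, v) \<in> parcs G ^^ k" unfolding k_def by (rule LeastI_ex)
  have shortest: "k \<le> l" if "(u, v) \<in> parcs G ^^ l" for l
    unfolding k_def using that by (rule Least_le)
  show ?thesis
    using graph_dist_eqI[OF assms(1,2) walk shortest] walk shortest by blast
qed

lemma graph_dist_self:
  assumes "pair_wf_digraph G" "u \<in> pverts G"
  shows "graph_dist G u u = 0"
  using graph_dist_eqI[OF assms, of u 0] by simp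

lemma graph_dist_sym:
  assumes "pair_wf_digraph G" "sym (parcs G)" "u \<in> pverts G" "v \<in> pverts G"
    and "(u, v) \<in> (parcs G)\<^sup>*"
  shows "graph_dist G u v = graph_dist G v u"
proof -
  have "(y, x) \<in> parcs G ^^ k" if "(x, y) \<in> parcs G ^^ k" for x y k
    using that
  proof (induction k arbitrary: y)
    case (Suc k)
    then obtain z where "(x, z) \<in> parcs G ^^ k" "(z, y) \<in> parcs G" by auto
    with Suc.IH assms(2) show ?case by (meson relpow_Suc_I2 symD)
  qed simp
  then have rev: "(x, y) \<in> parcs G ^^ k \<longleftrightarrow> (y, x) \<in> parcs G ^^ k" for x y k by blast
  obtain k where "graph_dist G u v = real k" "(u, v) \<in> parcs G ^^ k"
    "\<And>l. (u, v) \<in> parcs G ^^ l \<Longrightarrow> k \<le> l"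
    using graph_dist_attained[OF assms(1,3,5)] by blast
  moreover from this(2,3) have "graph_dist G v u = real k"
    by (intro graph_dist_eqI[OF assms(1,4)]) (simp_all add: rev)
  ultimately show ?thesis by simp
qed

lemma graph_dist_complete:
  assumes "complete_digraph m (with_proj K)" "x \<in> pverts K" "y \<in> pverts K"
  shows "graph_dist K x y = (if x = y then 0 else 1)"
proof -
  have arcs: "parcs K = {(u, v). (u, v) \<in> pverts K \<times> pverts K \<and> u \<noteq> v}"
    using assms(1) by (simp add: complete_digraph_pair_def)
  have wf: "pair_wf_digraph K" by (rule pair_wf_digraph.intro) (auto simp: arcs)
  show ?thesis
  proof (cases "x = y")
    case True
    then show ?thesis using graph_dist_self[OF wf] assms by simp
  next
    case False
    have "1 \<le> l" if "(x, y) \<in> parcs K ^^ l" for l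
      using that False by (cases l) auto
    moreover have "(x, y) \<in> parcs K ^^ 1" using False assms arcs by auto
    ultimately show ?thesis using graph_dist_eqI[OF wf assms(2), of y 1] False by simp
  qed
qed

lemma connected_imp_rtrancl_parcs:
  assumes "pair_graph G" "Digraph_Component.connected (with_proj G)"
    and "u \<in> pverts G" "v \<in> pverts G"
  shows "(u, v) \<in> (parcs G)\<^sup>*"
proof -
  interpret pair_graph G by fact
  have "strongly_connected (with_proj G)"
    using assms(2) sym_arcs by (intro symmetric_connected_imp_strongly_connected) auto
  then have "u \<rightarrow>\<^sup>*\<^bsub>with_proj G\<^esub> v" using assms(3,4) by auto
  then obtain p where "awalk u p v" by (auto simp: reachable_awalk)
  then show ?thesis using awalk_length_iff_relpow relpow_imp_rtrancl by blast
qed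

section \<open>The Cartesian product\<close>

lemma pverts_cartesian_product [simp]:
  "pverts (cartesian_product G H) = pverts G \<times> pverts H"
  by (simp add: cartesian_product_def)

lemma pair_wf_digraph_cartesian_product:
  assumes "pair_wf_digraph G" "pair_wf_digraph H"
  shows "pair_wf_digraph (cartesian_product G H)"
proof -
  interpret G: pair_wf_digraph G by fact
  interpret H: pair_wf_digraph H by fact
  show ?thesis
    by unfold_locales
      (auto simp: cartesian_product_def
        dest: G.in_arcsD1 G.in_arcsD2 H.in_arcsD1 H.in_arcsD2)
qed

text \<open>Each step of a walk in the product moves exactly one coordinate.\<close>

lemma relpow_cartesian_product_project:
  assumes "((x, u), (y, v)) \<in> parcs (cartesian_product G H) ^^ k"
  shows "\<exists>a b. k = a + b \<and> (x, y) \<in> parcs G ^^ a \<and> (u, v) \<in> parcs H ^^ b"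
  using assms
proof (induction k arbitrary: y v)
  case 0
  then show ?case by auto
next
  case (Suc k)
  then obtain y' v' where walk: "((x, u), (y', v')) \<in> parcs (cartesian_product G H) ^^ k"
    and step: "((y', v'), (y, v)) \<in> parcs (cartesian_product G H)"
    by auto
  from Suc.IH[OF walk] obtain a b
    where ab: "k = a + b" "(x, y') \<in> parcs G ^^ a" "(u, v') \<in> parcs H ^^ b" by blast
  from step consider "(y', y) \<in> parcs G" "v' = v" | "y' = y" "(v', v) \<in> parcs H"
    by (auto simp: cartesian_product_def)
  then show ?case
  proof cases
    case 1
    with ab show ?thesis by (intro exI[of _ "Suc a"] exI[of _ b]) auto
  next
    case 2
    with ab show ?thesis by (intro exI[of _ a] exI[of _ "Suc b"]) auto
  qed
qed

lemma relpow_cartesian_product_combine: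
  assumes wf: "pair_wf_digraph G" and "(x, y) \<in> parcs G ^^ a" "(u, v) \<in> parcs H ^^ b"
    and "x \<in> pverts G" "u \<in> pverts H"
  shows "((x, u), (y, v)) \<in> parcs (cartesian_product G H) ^^ (a + b)"
proof -
  let ?R = "parcs (cartesian_product G H)"
  have y: "y \<in> pverts G"
    using assms(2,4) pair_wf_digraph.in_arcsD2[OF wf] by (cases a) auto
  have "((x, u), (y, u)) \<in> ?R ^^ a" using assms(2)
  proof (induction a arbitrary: y)
    case (Suc a)
    then show ?case using assms(5) by (fastforce simp: cartesian_product_def)
  qed simp
  moreover have "((y, u), (y, v)) \<in> ?R ^^ b" using assms(3)
  proof (induction b arbitrary: v)
    case (Suc b)
    then show ?case using y by (fastforce simp: cartesian_product_def)
  qed simp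
  ultimately show ?thesis by (auto simp: relpow_add)
qed

lemma graph_dist_cartesian_product:
  assumes wf: "pair_wf_digraph G" "pair_wf_digraph H"
    and verts: "x \<in> pverts G" "u \<in> pverts H"
    and reach: "(x, y) \<in> (parcs G)\<^sup>*" "(u, v) \<in> (parcs H)\<^sup>*"
  shows "graph_dist (cartesian_product G H) (x, u) (y, v) = graph_dist G x y + graph_dist H u v"
proof -
  obtain a where a: "graph_dist G x y = real a" "(x, y) \<in> parcs G ^^ a"
    "\<And>l. (x, y) \<in> parcs G ^^ l \<Longrightarrow> a \<le> l"
    using graph_dist_attained[OF wf(1) verts(1) reach(1)] by blast
  obtain b where b: "graph_dist H u v = real b" "(u, v) \<in> parcs H ^^ b"
    "\<And>l. (u, v) \<in> parcs H ^^ l \<Longrightarrow> b \<le> l"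
    using graph_dist_attained[OF wf(2) verts(2) reach(2)] by blast
  have "graph_dist (cartesian_product G H) (x, u) (y, v) = real (a + b)"
  proof (rule graph_dist_eqI)
    show "pair_wf_digraph (cartesian_product G H)"
      using wf by (rule pair_wf_digraph_cartesian_product)
    show "(x, u) \<in> pverts (cartesian_product G H)" using verts by simp
    show "((x, u), (y, v)) \<in> parcs (cartesian_product G H) ^^ (a + b)"
      using relpow_cartesian_product_combine[OF wf(1) a(2) b(2) verts] .
    show "a + b \<le> l" if "((x, u), (y, v)) \<in> parcs (cartesian_product G H) ^^ l" for l
      using relpow_cartesian_product_project[OF that] a(3) b(3) add_mono by blast
  qed
  then show ?thesis by (simp add: a(1) b(1))
qed

text \<open>
  In matrix terms: writing \<open>J\<close> for all-ones matrices, the left-hand kernel is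
  \<open>(J - I) \<otimes> J + J \<otimes> d = J \<otimes> J - I \<otimes> J + J \<otimes> d\<close>, and every factor \<open>J\<close> sums \<open>f\<close> over a coordinate.
\<close>

lemma quad_form_complete_product:
  assumes "finite X"
  shows "quad_form (X \<times> V) (\<lambda>(x, u) (y, v). (if x = y then 0 else 1) + d u v) f =
    (\<Sum>p\<in>X \<times> V. f p)\<^sup>2 - (\<Sum>x\<in>X. (\<Sum>u\<in>V. f (x, u))\<^sup>2) + quad_form V d (\<lambda>u. \<Sum>x\<in>X. f (x, u))"
proof -
  have one: "quad_form (X \<times> V) (\<lambda>_ _. 1) f = (\<Sum>p\<in>X \<times> V. f p)\<^sup>2"
    using quad_form_rank_one[of "X \<times> V" "\<lambda>_. 1" "\<lambda>_. 1" f] by (simp add: power2_eq_square)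
  have diagonal: "quad_form (X \<times> V) (\<lambda>p q. of_bool (fst p = fst q)) f =
      (\<Sum>x\<in>X. (\<Sum>u\<in>V. f (x, u))\<^sup>2)"
  proof -
    have "(\<Sum>q\<in>X \<times> V. of_bool (x = fst q) * f q) = (\<Sum>v\<in>V. f (x, v))" if "x \<in> X" for x
    proof -
      have "(\<Sum>q\<in>X \<times> V. of_bool (x = fst q) * f q) =
          (\<Sum>y\<in>X. if x = y then \<Sum>v\<in>V. f (y, v) else 0)"
        unfolding sum.cartesian_product' by (intro sum.cong) auto
      then show ?thesis using assms that by (simp add: sum.delta')
    qed
    then have "quad_form (X \<times> V) (\<lambda>p q. of_bool (fst p = fst q)) f =
        (\<Sum>x\<in>X. \<Sum>u\<in>V. f (x, u) * (\<Sum>v\<in>V. f (x, v)))"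
      unfolding quad_form_def sum.cartesian_product'[of _ X V] by (intro sum.cong) auto
    then show ?thesis by (simp add: power2_eq_square flip: sum_distrib_right)
  qed
  have summed: "quad_form (X \<times> V) (\<lambda>p q. d (snd p) (snd q)) f =
      quad_form V d (\<lambda>u. \<Sum>x\<in>X. f (x, u))"
  proof -
    have "(\<Sum>q\<in>X \<times> V. d u (snd q) * f q) = (\<Sum>v\<in>V. d u v * (\<Sum>y\<in>X. f (y, v)))" for u
      unfolding sum.cartesian_product' sum_distrib_left by (subst sum.swap) simp
    then have "quad_form (X \<times> V) (\<lambda>p q. d (snd p) (snd q)) f =
        (\<Sum>x\<in>X. \<Sum>u\<in>V. f (x, u) * (\<Sum>v\<in>V. d u v * (\<Sum>y\<in>X. f (y, v))))"
      unfolding quad_form_def by (simp add: sum.cartesian_product')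
    also have "\<dots> = quad_form V d (\<lambda>u. \<Sum>x\<in>X. f (x, u))"
      unfolding quad_form_def sum_distrib_right by (rule sum.swap)
    finally show ?thesis .
  qed
  have "quad_form (X \<times> V) (\<lambda>(x, u) (y, v). (if x = y then 0 else 1) + d u v) f =
      quad_form (X \<times> V) (\<lambda>p q. (1 - of_bool (fst p = fst q)) + d (snd p) (snd q)) f"
    by (intro quad_form_cong) auto
  then show ?thesis by (simp add: quad_form_add quad_form_diff one diagonal summed)
qed

section \<open>The quadratic embedding constant\<close>

lemma QEC_eqI:
  assumes "(\<Sum>i\<in>pverts G. h i * h i) = 1" "(\<Sum>i\<in>pverts G. h i) = 0"
    and "quad_form (pverts G) (graph_dist G) h = q"
    and "\<And>f. (\<Sum>i\<in>pverts G. f i * f i) = 1 \<Longrightarrow> (\<Sum>i\<in>pverts G. f i) = 0 \<Longrightarrow>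
      quad_form (pverts G) (graph_dist G) f \<le> q"
  shows "QEC G = q"
  unfolding QEC_def quad_form_def[symmetric]
  using assms by (intro Greatest_equality) blast+

text \<open>
  By Schoenberg's criterion the distance form of a graph of non-QE class takes a positive value on some
  vector with sum zero. That vector cannot vanish; rescaled to norm 1 it shows both that the maximum
  is taken over a nonempty set and that it is positive. Homogeneity extends the bound to all vectors
  with sum zero.
\<close>

lemma non_QE_class_maximizer:
  assumes "pair_graph G" "Digraph_Component.connected (with_proj G)" "\<not> QE_class G"
  shows "QEC G > 0"
    and "\<exists>h. (\<Sum>i\<in>pverts G. h i * h i) = 1 \<and> (\<Sum>i\<in>pverts G. h i) = 0 \<and>
      quad_form (pverts G) (graph_dist G) h = QEC G"
    and "\<And>g. (\<Sum>i\<in>pverts G. g i) = 0 \<Longrightarrow>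
      quad_form (pverts G) (graph_dist G) g \<le> QEC G * (\<Sum>i\<in>pverts G. g i * g i)"
proof -
  interpret pair_graph G by fact
  let ?V = "pverts G" and ?Q = "quad_form (pverts G) (graph_dist G)"
  have fin: "finite ?V" by (rule pair_finite_verts)
  have wf: "pair_wf_digraph G" by unfold_locales
  have sym: "graph_dist G i j = graph_dist G j i" if "i \<in> ?V" "j \<in> ?V" for i j
    using graph_dist_sym[OF wf _ that connected_imp_rtrancl_parcs[OF assms(1,2) that]] pair_sym_arcs
    by (simp add: symmetric_def)
  have "\<exists>g. (\<Sum>i\<in>?V. g i) = 0 \<and> ?Q g > 0"
  proof (rule ccontr)
    assume "\<not> (\<exists>g. (\<Sum>i\<in>?V. g i) = 0 \<and> ?Q g > 0)"
    then have neg: "?Q g \<le> 0" if "(\<Sum>i\<in>?V. g i) = 0" for g using that not_le by blast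
    have "QE_class G"
      unfolding QE_class_def
      by (rule conditionally_negative_imp_squared_distances[OF fin sym graph_dist_self[OF wf] neg])
    with assms(3) show False by simp
  qed
  then obtain g0 where g0: "(\<Sum>i\<in>?V. g0 i) = 0" "?Q g0 > 0" by blast
  define normalize where "normalize g = (\<lambda>i. (1 / sqrt (\<Sum>i\<in>?V. g i * g i)) * g i)"
    for g :: "'a \<Rightarrow> real"
  have normalize: "(\<Sum>i\<in>?V. normalize g i * normalize g i) = 1"
    "(\<Sum>i\<in>?V. normalize g i) = 0" "?Q g = ?Q (normalize g) * (\<Sum>i\<in>?V. g i * g i)"
    if "(\<Sum>i\<in>?V. g i) = 0" and pos: "(\<Sum>i\<in>?V. g i * g i) > 0" for g
  proof -
    let ?r = "sqrt (\<Sum>i\<in>?V. g i * g i)"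
    have sq: "(1 / ?r)\<^sup>2 * (\<Sum>i\<in>?V. g i * g i) = 1" using pos by (simp add: power_divide)
    have "(\<Sum>i\<in>?V. normalize g i * normalize g i) = (1 / ?r)\<^sup>2 * (\<Sum>i\<in>?V. g i * g i)"
      unfolding normalize_def sum_distrib_left by (simp add: power2_eq_square mult_ac)
    then show "(\<Sum>i\<in>?V. normalize g i * normalize g i) = 1" using sq by simp
    show "(\<Sum>i\<in>?V. normalize g i) = 0"
      unfolding normalize_def sum_distrib_left[symmetric] that by simp
    show "?Q g = ?Q (normalize g) * (\<Sum>i\<in>?V. g i * g i)"
      unfolding normalize_def quad_form_scale using sq by (simp add: mult_ac)
  qed
  have null: "?Q g = 0" if "\<not> (\<Sum>i\<in>?V. g i * g i) > 0" for g
  proof -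
    have "(\<Sum>i\<in>?V. g i * g i) = 0"
      using that sum_nonneg[of ?V "\<lambda>i. g i * g i"] by simp
    then have "\<forall>i\<in>?V. g i = 0" using fin by (simp add: sum_nonneg_eq_0_iff)
    then show ?thesis by (simp add: quad_form_def)
  qed
  have pos0: "(\<Sum>i\<in>?V. g0 i * g0 i) > 0" using null[of g0] g0(2) by linarith
  obtain h where h: "(\<Sum>i\<in>?V. h i * h i) = 1" "(\<Sum>i\<in>?V. h i) = 0"
    "\<And>f. (\<Sum>i\<in>?V. f i * f i) = 1 \<Longrightarrow> (\<Sum>i\<in>?V. f i) = 0 \<Longrightarrow> ?Q f \<le> ?Q h"
    using quad_form_attains_max[OF fin normalize(1,2)[OF g0(1) pos0]] by blast
  have QEC: "QEC G = ?Q h" using h by (intro QEC_eqI) auto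
  show bound: "?Q g \<le> QEC G * (\<Sum>i\<in>?V. g i * g i)" if g: "(\<Sum>i\<in>?V. g i) = 0" for g
  proof (cases "(\<Sum>i\<in>?V. g i * g i) > 0")
    case True
    then show ?thesis
      using h(3)[OF normalize(1,2)[OF g True]] normalize(3)[OF g True] QEC by simp
  next
    case False
    then show ?thesis
      using null[OF False] sum_nonneg[of ?V "\<lambda>i. g i * g i"] by simp
  qed
  show "QEC G > 0"
    using bound[OF g0(1)] g0(2) pos0 by (meson less_le_trans zero_less_mult_pos2)
  show "\<exists>h. (\<Sum>i\<in>?V. h i * h i) = 1 \<and> (\<Sum>i\<in>?V. h i) = 0 \<and> ?Q h = QEC G"
    using h(1,2) QEC by auto
qed

theorem theorem1p4:
  fixes G :: "'a pair_pre_digraph" and K :: "'b pair_pre_digraph" and n m :: nat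
  assumes "pair_graph G"
    and "Digraph_Component.connected (with_proj G)"
    and "card (pverts G) = n"
    and "\<not> QE_class G"
    and "m \<ge> 1"
    and "complete_digraph m (with_proj K)"
  shows "QEC (cartesian_product K G) = real m * QEC G"
proof -
  interpret pair_graph G by fact
  let ?V = "pverts G" and ?X = "pverts K" and ?d = "graph_dist G"
  let ?D = "graph_dist (cartesian_product K G)"
  have finX: "finite ?X" and cardX: "card ?X = m"
    and arcsK: "parcs K = {(x, y). (x, y) \<in> ?X \<times> ?X \<and> x \<noteq> y}"
    using assms(6) by (simp_all add: complete_digraph_pair_def)
  have wfK: "pair_wf_digraph K" by (rule pair_wf_digraph.intro) (auto simp: arcsK)
  have wfG: "pair_wf_digraph G" by unfold_locales
  obtain h where h: "(\<Sum>u\<in>?V. h u * h u) = 1" "(\<Sum>u\<in>?V. h u) = 0" "quad_form ?V ?d h = QEC G"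
    using non_QE_class_maximizer(2)[OF assms(1,2,4)] by blast
  note pos = non_QE_class_maximizer(1)[OF assms(1,2,4)]
  note bound = non_QE_class_maximizer(3)[OF assms(1,2,4)]
  have dist: "?D (x, u) (y, v) = (if x = y then 0 else 1) + ?d u v"
    if "x \<in> ?X" "y \<in> ?X" "u \<in> ?V" "v \<in> ?V" for x y u v
  proof -
    have "(x, y) \<in> (parcs K)\<^sup>*" using arcsK that by (cases "x = y") auto
    then show ?thesis
      using graph_dist_cartesian_product[OF wfK wfG that(1,3) _
          connected_imp_rtrancl_parcs[OF assms(1,2) that(3,4)]]
        graph_dist_complete[OF assms(6) that(1,2)] by simp
  qed
  have form: "quad_form (?X \<times> ?V) ?D f =
      (\<Sum>p\<in>?X \<times> ?V. f p)\<^sup>2 - (\<Sum>x\<in>?X. (\<Sum>u\<in>?V. f (x, u))\<^sup>2)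
        + quad_form ?V ?d (\<lambda>u. \<Sum>x\<in>?X. f (x, u))" for f
    unfolding quad_form_complete_product[OF finX, symmetric]
    using dist by (intro quad_form_cong) auto
  show ?thesis
  proof (rule QEC_eqI, unfold pverts_cartesian_product)
    \<comment> \<open>equality case: copy the maximizer of \<open>G\<close> onto every layer\<close>
    let ?f = "\<lambda>(x, u). h u / sqrt (real m)"
    have "(\<Sum>p\<in>?X \<times> ?V. ?f p * ?f p) = (\<Sum>x\<in>?X. (\<Sum>u\<in>?V. h u * h u) / real m)"
      unfolding sum.cartesian_product' by (simp add: sum_divide_distrib)
    then show "(\<Sum>p\<in>?X \<times> ?V. ?f p * ?f p) = 1"
      using h(1) cardX assms(5) by simp
    have layer: "(\<Sum>u\<in>?V. ?f (x, u)) = 0" for x :: 'b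
      using h(2) by (simp flip: sum_divide_distrib)
    then show sum: "(\<Sum>p\<in>?X \<times> ?V. ?f p) = 0"
      unfolding sum.cartesian_product' by simp
    have "(\<Sum>x\<in>?X. ?f (x, u)) = (real m / sqrt (real m)) * h u" for u
      by (simp add: cardX)
    then have "(\<lambda>u. \<Sum>x\<in>?X. ?f (x, u)) = (\<lambda>u. sqrt (real m) * h u)"
      by (simp only: real_div_sqrt of_nat_0_le_iff)
    then show "quad_form (?X \<times> ?V) ?D ?f = real m * QEC G"
      unfolding form sum layer by (simp add: quad_form_scale h(3))
  next
    fix f :: "'b \<times> 'a \<Rightarrow> real"
    assume f: "(\<Sum>p\<in>?X \<times> ?V. f p * f p) = 1" "(\<Sum>p\<in>?X \<times> ?V. f p) = 0"
    define g where "g u = (\<Sum>x\<in>?X. f (x, u))" for u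
    have g0: "(\<Sum>u\<in>?V. g u) = 0"
      using f(2) unfolding g_def sum.cartesian_product' by (subst sum.swap) simp
    have "(\<Sum>u\<in>?V. g u * g u) \<le> (\<Sum>u\<in>?V. (\<Sum>x\<in>?X. (f (x, u))\<^sup>2) * real m)"
      using sum_squared_le_sum_of_squares[of _ ?X] cardX
      by (intro sum_mono) (simp add: g_def power2_eq_square)
    also have "\<dots> = (\<Sum>p\<in>?X \<times> ?V. f p * f p) * real m"
      unfolding sum.cartesian_product' sum_distrib_right[symmetric]
      by (subst sum.swap) (simp add: power2_eq_square)
    finally have norm: "(\<Sum>u\<in>?V. g u * g u) \<le> real m" using f(1) by simp
    have "quad_form (?X \<times> ?V) ?D f \<le> quad_form ?V ?d g"
      unfolding form f(2) g_def by (simp add: sum_nonneg)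
    also have "\<dots> \<le> QEC G * (\<Sum>u\<in>?V. g u * g u)" using bound[OF g0] .
    also have "\<dots> \<le> QEC G * real m" using norm pos by (intro mult_left_mono) auto
    finally show "quad_form (?X \<times> ?V) ?D f \<le> real m * QEC G" by (simp add: mult.commute)
  qed
qed

end
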